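(* Let $\Gamma$ be a finite connected graph, let $A$ be a finite solvable group with a finite series $1=A^{(d+1)}\vartriangleleft A^{(d)}\vartriangleleft\cdots\vartriangleleft A^{(0)}=A$ such that for each $i\in\{0,1,\dots,d\}$, $A^{(i)}$ is a characteristic subgroup of $A$ and $A^{(i)}/A^{(i+1)}$ is abelian, and let $\phi:D(\Gamma)\to A$ be a voltage assignment with $\Gamma\times_\phi A$ connected. Let $\Gamma^{(0)}=\Gamma,\Gamma^{(1)},\dots,\Gamma^{(d+1)}$ be the associated tower of abelian covers $\Gamma^{(i)}\to\Gamma^{(i-1)}$. Then an automorphism $\alpha^{(0)}\in\mathrm{Aut}(\Gamma)$ can be lifted to the solvable cover $\Gamma\times_\phi A$ if and only if there exist automorphisms $\alpha^{(i)}\in\mathrm{Aut}(\Gamma^{(i)})$, $i=1,\dots,d+1$, such that, for each $i$, $\alpha^{(i)}$ is a lift of $\alpha^{(i-1)}$ along the abelian cover $\Gamma^{(i)}\to\Gamma^{(i-1)}$.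
   Context: All graphs are finite and connected (including covering graphs). For a graph $\Gamma$, $V(\Gamma)$ and $D(\Gamma)$ are the sets of vertices and arcs (each edge gives two opposite arcs $x,x^{-1}$); $s(x),t(x)$ are the starting and terminal vertices of $x$. A graph automorphism consists of bijections on vertices and on arcs, compatible with $s$, $t$ and arc reversal. A voltage assignment in a finite group $G$ is a map $\phi:D(\Gamma)\to G$ with $\phi(x^{-1})=\phi(x)^{-1}$. The derived graph $\Gamma\times_\phi G$ has vertex set $V(\Gamma)\times G$ and arc set $D(\Gamma)\times G$ (elements $\langle x,g\rangle$), with $s\langle x,g\rangle=(s(x),g)$, $t\langle x,g\rangle=(t(x),g\phi(x))$ and $\langle x,g\rangle^{-1}=\langle x^{-1},g\phi(x)\rangle$; it projects to $\Gamma$ by the first coordinate. A lift of $\alpha\in\mathrm{Aut}(\Gamma)$ along a cover $\pi:\tilde\Gamma\to\Gamma$ is $\tilde\alpha\in\mathrm{Aut}(\tilde\Gamma)$ with $\pi\circ\tilde\alpha=\alpha\circ\pi$. Tower: for each $i\in\{0,\dots,d\}$ a section $\kappa^{(i)}:A^{(i)}/A^{(i+1)}\to A^{(i)}$ is fixed, i.e. a function which is a right inverse of the quotient map, with $\kappa^{(i)}(1)=1$. Put $\Gamma^{(0)}=\Gamma$, $\phi^{(0)}=\phi$, and recursively for $i=0,\dots,d$: let $\overline\phi^{(i)}:D(\Gamma^{(i)})\to A^{(i)}/A^{(i+1)}$ be the composite of $\phi^{(i)}:D(\Gamma^{(i)})\to A^{(i)}$ with the quotient homomorphism, let $\Gamma^{(i+1)}=\Gamma^{(i)}\times_{\overline\phi^{(i)}}(A^{(i)}/A^{(i+1)})$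 with its projection to $\Gamma^{(i)}$, and let $\phi^{(i+1)}:D(\Gamma^{(i+1)})\to A^{(i+1)}$ be given by $\phi^{(i+1)}\langle x,q\rangle=\kappa^{(i)}(q)\,\phi^{(i)}(x)\,[\kappa^{(i)}(q\overline\phi^{(i)}(x))]^{-1}$. *)

theory Defs
  imports "Graph_Theory.Graph_Theory" "HOL-Algebra.Algebra"
begin

section \<open>Graphs, automorphisms, lifts\<close>

text \<open>
  Multigraphs with loops, given by arcs and arc reversal.  The locale
  \<^locale>\<open>bidirected_digraph\<close> makes the reversal a fixed-point free involution on the
  arcs (so there are no semi-edges), and also normalises it to be the identity on
  non-arcs; this is the reason for the conditionals in the \<open>arc_inv\<close> fields below.
\<close>

record ('v, 'e) vgraph = "('v, 'e) pre_digraph" +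
  arc_inv :: "'e \<Rightarrow> 'e"

definition finite_graph :: "('v, 'e) vgraph \<Rightarrow> bool" where
  "finite_graph \<Gamma> \<longleftrightarrow>
     fin_digraph (pre_digraph.truncate \<Gamma>) \<and>
     bidirected_digraph (pre_digraph.truncate \<Gamma>) (arc_inv \<Gamma>)"

definition connected_graph :: "('v, 'e) vgraph \<Rightarrow> bool" where
  "connected_graph \<Gamma> \<longleftrightarrow> connected (pre_digraph.truncate \<Gamma>)"

text \<open>A map of graphs is a pair of functions, on vertices and on arcs.\<close>

definition graph_automorphism ::
    "('v, 'e) vgraph \<Rightarrow> ('v \<Rightarrow> 'v) \<times> ('e \<Rightarrow> 'e) \<Rightarrow> bool" where
  "graph_automorphism \<Gamma> \<alpha> \<longleftrightarrow>
     bij_betw (fst \<alpha>) (verts \<Gamma>) (verts \<Gamma>) \<and>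
     bij_betw (snd \<alpha>) (arcs \<Gamma>) (arcs \<Gamma>) \<and>
     (\<forall>x\<in>arcs \<Gamma>. tail \<Gamma> (snd \<alpha> x) = fst \<alpha> (tail \<Gamma> x) \<and>
                 head \<Gamma> (snd \<alpha> x) = fst \<alpha> (head \<Gamma> x) \<and>
                 arc_inv \<Gamma> (snd \<alpha> x) = snd \<alpha> (arc_inv \<Gamma> x))"

definition is_lift ::
    "('w, 'f) vgraph \<Rightarrow> ('w \<Rightarrow> 'v) \<times> ('f \<Rightarrow> 'e) \<Rightarrow>
     ('w \<Rightarrow> 'w) \<times> ('f \<Rightarrow> 'f) \<Rightarrow> ('v \<Rightarrow> 'v) \<times> ('e \<Rightarrow> 'e) \<Rightarrow> bool" where
  "is_lift \<Gamma>' \<pi> \<alpha>' \<alpha> \<longleftrightarrow>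
     graph_automorphism \<Gamma>' \<alpha>' \<and>
     (\<forall>v\<in>verts \<Gamma>'. fst \<pi> (fst \<alpha>' v) = fst \<alpha> (fst \<pi> v)) \<and>
     (\<forall>x\<in>arcs \<Gamma>'. snd \<pi> (snd \<alpha>' x) = snd \<alpha> (snd \<pi> x))"


section \<open>Voltage assignments and derived graphs\<close>

definition voltage_assignment ::
    "('v, 'e) vgraph \<Rightarrow> ('g, 'm) monoid_scheme \<Rightarrow> ('e \<Rightarrow> 'g) \<Rightarrow> bool" where
  "voltage_assignment \<Gamma> G \<phi> \<longleftrightarrow>
     (\<forall>x\<in>arcs \<Gamma>. \<phi> x \<in> carrier G \<and> \<phi> (arc_inv \<Gamma> x) = inv\<^bsub>G\<^esub> (\<phi> x))"

definition derived_graph ::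
    "('v, 'e) vgraph \<Rightarrow> ('g, 'm) monoid_scheme \<Rightarrow> ('e \<Rightarrow> 'g) \<Rightarrow> ('v \<times> 'g, 'e \<times> 'g) vgraph" where
  "derived_graph \<Gamma> G \<phi> =
     \<lparr>verts = verts \<Gamma> \<times> carrier G,
      arcs = arcs \<Gamma> \<times> carrier G,
      tail = (\<lambda>(x, g). (tail \<Gamma> x, g)),
      head = (\<lambda>(x, g). (head \<Gamma> x, g \<otimes>\<^bsub>G\<^esub> \<phi> x)),
      arc_inv = (\<lambda>(x, g). if (x, g) \<in> arcs \<Gamma> \<times> carrier G
                          then (arc_inv \<Gamma> x, g \<otimes>\<^bsub>G\<^esub> \<phi> x) else (x, g))\<rparr>"


section \<open>Characteristic series\<close>

definition characteristic_subgroup :: "'g set \<Rightarrow> ('g, 'm) monoid_scheme \<Rightarrow> bool" where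
  "characteristic_subgroup H G \<longleftrightarrow> subgroup H G \<and> (\<forall>f\<in>auto G. f ` H = H)"

abbreviation series_factor :: "('g, 'm) monoid_scheme \<Rightarrow> (nat \<Rightarrow> 'g set) \<Rightarrow> nat \<Rightarrow> 'g set monoid" where
  "series_factor A N i \<equiv> (A\<lparr>carrier := N i\<rparr>) Mod N (Suc i)"

definition characteristic_abelian_series ::
    "('g, 'm) monoid_scheme \<Rightarrow> nat \<Rightarrow> (nat \<Rightarrow> 'g set) \<Rightarrow> bool" where
  "characteristic_abelian_series A d N \<longleftrightarrow>
     N 0 = carrier A \<and> N (Suc d) = {\<one>\<^bsub>A\<^esub>} \<and>
     (\<forall>i\<le>d. N (Suc i) \<lhd> A\<lparr>carrier := N i\<rparr> \<and>
            characteristic_subgroup (N i) A \<and>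
            comm_group (series_factor A N i))"

text \<open>
  \<open>\<kappa> i\<close> is a normalised section of the quotient map \<open>a \<mapsto> N (Suc i) a\<close>
  from \<open>N i\<close> onto \<open>N i / N (Suc i)\<close>.
\<close>

definition series_sections ::
    "('g, 'm) monoid_scheme \<Rightarrow> nat \<Rightarrow> (nat \<Rightarrow> 'g set) \<Rightarrow> (nat \<Rightarrow> 'g set \<Rightarrow> 'g) \<Rightarrow> bool" where
  "series_sections A d N \<kappa> \<longleftrightarrow>
     (\<forall>i\<le>d. (\<forall>q\<in>carrier (series_factor A N i).
               \<kappa> i q \<in> N i \<and> N (Suc i) #>\<^bsub>A\<^esub> \<kappa> i q = q) \<and>
            \<kappa> i \<one>\<^bsub>series_factor A N i\<^esub> = \<one>\<^bsub>A\<^esub>)"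


section \<open>The tower of abelian covers\<close>

text \<open>
  Each derived graph construction adds a factor to the types of vertices and arcs.  To have
  all the graphs \<open>\<Gamma>\<^sup>(\<^sup>i\<^sup>)\<close> in one type, a point \<open>b\<close> of the base graph is written \<open>Base b\<close>, and
  a point \<open>(x, q)\<close> of a derived graph over a level of the tower is written \<open>Over x q\<close>.
\<close>

datatype ('b, 'q) tower_pt = Base 'b | Over (under: "('b, 'q) tower_pt") 'q

definition relabel ::
    "('v \<Rightarrow> 'w) \<Rightarrow> ('e \<Rightarrow> 'f) \<Rightarrow> ('v, 'e) vgraph \<Rightarrow> ('w, 'f) vgraph" where
  \<comment> \<open>only used for injective \<open>a\<close> and \<open>b\<close>\<close>
  "relabel a b \<Gamma> =
     \<lparr>verts = a ` verts \<Gamma>,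
      arcs = b ` arcs \<Gamma>,
      tail = (\<lambda>y. a (tail \<Gamma> (inv_into (arcs \<Gamma>) b y))),
      head = (\<lambda>y. a (head \<Gamma> (inv_into (arcs \<Gamma>) b y))),
      arc_inv = (\<lambda>y. if y \<in> b ` arcs \<Gamma> then b (arc_inv \<Gamma> (inv_into (arcs \<Gamma>) b y)) else y)\<rparr>"

text \<open>
  \<open>tower_volt A N \<kappa> \<phi> i\<close> is \<open>\<phi>\<^sup>(\<^sup>i\<^sup>)\<close>, with values in \<open>N i\<close>; it is unspecified on points that
  do not have exactly \<open>i\<close> occurrences of \<open>Over\<close>.
\<close>

fun tower_volt ::
    "('g, 'm) monoid_scheme \<Rightarrow> (nat \<Rightarrow> 'g set) \<Rightarrow> (nat \<Rightarrow> 'g set \<Rightarrow> 'g) \<Rightarrow> ('e \<Rightarrow> 'g) \<Rightarrow>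
     nat \<Rightarrow> ('e, 'g set) tower_pt \<Rightarrow> 'g" where
  "tower_volt A N \<kappa> \<phi> 0 (Base x) = \<phi> x"
| "tower_volt A N \<kappa> \<phi> (Suc i) (Over x q) =
     (let u = tower_volt A N \<kappa> \<phi> i x
      in \<kappa> i q \<otimes>\<^bsub>A\<^esub> u \<otimes>\<^bsub>A\<^esub>
         inv\<^bsub>A\<^esub> (\<kappa> i (q \<otimes>\<^bsub>series_factor A N i\<^esub> (N (Suc i) #>\<^bsub>A\<^esub> u))))"

definition tower_volt_bar ::
    "('g, 'm) monoid_scheme \<Rightarrow> (nat \<Rightarrow> 'g set) \<Rightarrow> (nat \<Rightarrow> 'g set \<Rightarrow> 'g) \<Rightarrow> ('e \<Rightarrow> 'g) \<Rightarrow>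
     nat \<Rightarrow> ('e, 'g set) tower_pt \<Rightarrow> 'g set" where
  "tower_volt_bar A N \<kappa> \<phi> i x = N (Suc i) #>\<^bsub>A\<^esub> tower_volt A N \<kappa> \<phi> i x"

primrec tower ::
    "('v, 'e) vgraph \<Rightarrow> ('g, 'm) monoid_scheme \<Rightarrow> (nat \<Rightarrow> 'g set) \<Rightarrow> (nat \<Rightarrow> 'g set \<Rightarrow> 'g) \<Rightarrow>
     ('e \<Rightarrow> 'g) \<Rightarrow> nat \<Rightarrow> (('v, 'g set) tower_pt, ('e, 'g set) tower_pt) vgraph" where
  "tower \<Gamma> A N \<kappa> \<phi> 0 = relabel Base Base \<Gamma>"
| "tower \<Gamma> A N \<kappa> \<phi> (Suc i) =
     relabel (case_prod Over) (case_prod Over)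
       (derived_graph (tower \<Gamma> A N \<kappa> \<phi> i) (series_factor A N i) (tower_volt_bar A N \<kappa> \<phi> i))"

text \<open>
  The map that an automorphism of the base graph induces on \<open>\<Gamma>\<^sup>(\<^sup>0\<^sup>)\<close>, i.e. on the points of
  the form \<open>Base b\<close> (its values elsewhere are irrelevant).
\<close>

definition base_map ::
    "('v \<Rightarrow> 'v) \<times> ('e \<Rightarrow> 'e) \<Rightarrow>
     (('v, 'q) tower_pt \<Rightarrow> ('v, 'q) tower_pt) \<times> (('e, 'q) tower_pt \<Rightarrow> ('e, 'q) tower_pt)" where
  "base_map \<alpha> = (map_tower_pt (fst \<alpha>) id, map_tower_pt (snd \<alpha>) id)"

end

theory Submission
  imports Defs
begin

text \<open>
  Write \<open>D\<close> for \<open>\<Gamma> \<times>\<^sub>\<phi> A\<close> and \<open>T i\<close> for the graph at level \<open>i\<close> of the tower.  All levels of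
  the tower are quotients of the single graph \<open>D\<close>.  The group \<open>A\<close> acts on \<open>D\<close> by left
  translations \<open>c \<cdot> (v, a) = (v, c a)\<close>, and there is a morphism \<open>p\<^sub>i\<close> from \<open>D\<close> onto \<open>T i\<close> whose
  fibres are exactly the orbits of \<open>N i\<close>; the composite of \<open>p\<^sub>i\<^sub>+\<^sub>1\<close> with the projection of
  \<open>T (i + 1)\<close> to \<open>T i\<close> is \<open>p\<^sub>i\<close>.  Since \<open>N (d + 1)\<close> is trivial, \<open>p\<^sub>d\<^sub>+\<^sub>1\<close> is an isomorphism from
  \<open>D\<close> to the top of the tower.  This is the content of \<open>solvable_cover_onto_tower\<close>,
  \<open>translate_in_fibre\<close> and \<open>same_fibre_translate\<close>.

  A chain of lifts through the tower ends in an automorphism of \<open>T (d + 1)\<close>, and conjugating it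
  with \<open>p\<^sub>d\<^sub>+\<^sub>1\<close> gives the lift to \<open>D\<close> (\<open>lifts_from_tower\<close>).

  Conversely, let \<open>\<beta>\<close> be a lift to \<open>D\<close>.  As \<open>D\<close> is connected, \<open>\<beta>\<close> normalises the group of left
  translations: there is an automorphism \<open>f\<close> of \<open>A\<close> such that \<open>\<beta>\<close> carries translation by \<open>c\<close> to
  translation by \<open>f c\<close> (\<open>lift_twists_translations\<close>).  The subgroups \<open>N i\<close> are characteristic, so
  \<open>f\<close> preserves them, \<open>\<beta>\<close> permutes the orbits of each \<open>N i\<close>, and hence it induces an
  automorphism of every \<open>T i\<close> (\<open>lift_descends_to_tower\<close>).  The induced automorphisms are
  compatible with the projections because they all come from the same \<open>\<beta>\<close>.
\<close>

section \<open>Morphisms of graphs\<close>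

text \<open>
  The part of well-formedness of a graph that survives both the formation of derived graphs and
  the passage to images.
\<close>

definition closed_graph :: "('v, 'e) vgraph \<Rightarrow> bool" where
  "closed_graph G \<longleftrightarrow>
     (\<forall>x\<in>arcs G. tail G x \<in> verts G \<and> head G x \<in> verts G \<and> arc_inv G x \<in> arcs G)"

definition graph_epimorphism ::
    "('v, 'e) vgraph \<Rightarrow> ('w, 'f) vgraph \<Rightarrow> ('v \<Rightarrow> 'w) \<times> ('e \<Rightarrow> 'f) \<Rightarrow> bool" where
  "graph_epimorphism G H p \<longleftrightarrow>
     fst p ` verts G = verts H \<and> snd p ` arcs G = arcs H \<and>
     (\<forall>x\<in>arcs G. tail H (snd p x) = fst p (tail G x) \<and>
                 head H (snd p x) = fst p (head G x) \<and>
                 arc_inv H (snd p x) = snd p (arc_inv G x))"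

lemma epimorphism_images:
  assumes "graph_epimorphism G H p"
  shows "fst p ` verts G = verts H" and "snd p ` arcs G = arcs H"
  using assms unfolding graph_epimorphism_def by simp_all

lemma epimorphism_ends:
  assumes "graph_epimorphism G H p" and "x \<in> arcs G"
  shows "tail H (snd p x) = fst p (tail G x)" and "head H (snd p x) = fst p (head G x)"
    and "arc_inv H (snd p x) = snd p (arc_inv G x)"
  using assms(1)[unfolded graph_epimorphism_def, THEN conjunct2, THEN conjunct2, rule_format,
      OF assms(2)] by simp_all

lemma automorphism_images:
  assumes "graph_automorphism G \<alpha>"
  shows "fst \<alpha> ` verts G = verts G" and "snd \<alpha> ` arcs G = arcs G"
  using assms unfolding graph_automorphism_def bij_betw_def by simp_all

lemma automorphism_ends:
  assumes "graph_automorphism G \<alpha>" and "x \<in> arcs G"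
  shows "tail G (snd \<alpha> x) = fst \<alpha> (tail G x)" and "head G (snd \<alpha> x) = fst \<alpha> (head G x)"
    and "arc_inv G (snd \<alpha> x) = snd \<alpha> (arc_inv G x)"
  using assms(1)[unfolded graph_automorphism_def, THEN conjunct2, THEN conjunct2, rule_format,
      OF assms(2)] by simp_all

lemma finite_graph_closed:
  assumes "finite_graph G"
  shows "closed_graph G" and "finite (verts G)" and "finite (arcs G)"
proof -
  interpret fin_digraph "pre_digraph.truncate G"
    using assms by (simp add: finite_graph_def)
  interpret bidirected_digraph "pre_digraph.truncate G" "arc_inv G"
    using assms by (simp add: finite_graph_def)
  show "finite (verts G)" "finite (arcs G)"
    using finite_verts finite_arcs by (simp_all add: pre_digraph.truncate_def)
  show "closed_graph G"
    unfolding closed_graph_def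
    using wellformed arev_dom arev_arev_raw
    by (simp add: pre_digraph.truncate_def)
qed

text \<open>
  Lifts to a connected cover are rigid for this reason: what is preserved along every arc cannot
  differ between two vertices, so it may be read off at a single one.
\<close>

lemma connected_graph_invariant:
  assumes conn: "connected_graph G"
    and inv: "\<And>x. x \<in> arcs G \<Longrightarrow> P (tail G x) = P (head G x)"
    and u: "u \<in> verts G" and v: "v \<in> verts G"
  shows "P u = P v"
proof -
  let ?S = "with_proj (mk_symmetric (pre_digraph.truncate G))"
  have "(u, v) \<in> rtrancl_on (verts ?S) (arcs_ends ?S)"
    using conn u v
    by (simp add: connected_graph_def connected_def strongly_connected_def reachable_def
        mk_symmetric_def pre_digraph.truncate_def)
  then show ?thesis
  proof (induction rule: rtrancl_on_induct)
    case (step y z)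
    from \<open>(y, z) \<in> arcs_ends ?S\<close> obtain x where "x \<in> arcs G"
      and "(y, z) = (tail G x, head G x) \<or> (y, z) = (head G x, tail G x)"
      by (auto simp: mk_symmetric_def pre_digraph.truncate_def arcs_ends_def arc_to_ends_def)
    then have "P y = P z" using inv by auto
    with step.IH show ?case by simp
  qed simp
qed

text \<open>
  The induced map on the quotient is onto because \<open>\<beta>\<close> and \<open>p\<close> are; finiteness of the quotient then
  makes it injective, although \<open>\<beta>\<close> is only assumed to send fibres into fibres.
\<close>

lemma map_descends:
  assumes p: "p ` S = R" and S: "\<beta> ` S = S" and R: "finite R"
    and fibres: "\<And>x y. x \<in> S \<Longrightarrow> y \<in> S \<Longrightarrow> p x = p y \<Longrightarrow> p (\<beta> x) = p (\<beta> y)"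
  obtains a where "bij_betw a R R" and "\<And>x. x \<in> S \<Longrightarrow> a (p x) = p (\<beta> x)"
proof
  let ?a = "\<lambda>y. p (\<beta> (inv_into S p y))"
  show a: "?a (p x) = p (\<beta> x)" if "x \<in> S" for x
    using that by (intro fibres) (auto simp: inv_into_into f_inv_into_f)
  have "?a ` R = (\<lambda>x. ?a (p x)) ` S" by (simp flip: p add: image_image)
  also have "\<dots> = p ` \<beta> ` S" using a by (auto simp: image_image)
  also have "\<dots> = R" by (simp add: p S)
  finally have "?a ` R = R" .
  then show "bij_betw ?a R R"
    using R by (simp add: bij_betw_def eq_card_imp_inj_on)
qed

lemma automorphism_descends:
  assumes G: "closed_graph G" and p: "graph_epimorphism G H p"
    and fin: "finite (verts H)" "finite (arcs H)"
    and \<beta>: "graph_automorphism G \<beta>"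
    and fibre_verts: "\<And>v w. v \<in> verts G \<Longrightarrow> w \<in> verts G \<Longrightarrow> fst p v = fst p w \<Longrightarrow>
           fst p (fst \<beta> v) = fst p (fst \<beta> w)"
    and fibre_arcs: "\<And>x y. x \<in> arcs G \<Longrightarrow> y \<in> arcs G \<Longrightarrow> snd p x = snd p y \<Longrightarrow>
           snd p (snd \<beta> x) = snd p (snd \<beta> y)"
  obtains \<alpha> where "graph_automorphism H \<alpha>"
    and "\<And>v. v \<in> verts G \<Longrightarrow> fst \<alpha> (fst p v) = fst p (fst \<beta> v)"
    and "\<And>x. x \<in> arcs G \<Longrightarrow> snd \<alpha> (snd p x) = snd p (snd \<beta> x)"
proof -
  have \<beta>_verts: "fst \<beta> ` verts G = verts G" and \<beta>_arcs: "snd \<beta> ` arcs G = arcs G"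
    using \<beta> by (rule automorphism_images)+
  have p_verts: "fst p ` verts G = verts H" and p_arcs: "snd p ` arcs G = arcs H"
    using p by (rule epimorphism_images)+
  obtain a where a: "bij_betw a (verts H) (verts H)"
    and ap: "\<And>v. v \<in> verts G \<Longrightarrow> a (fst p v) = fst p (fst \<beta> v)"
    using map_descends[OF p_verts \<beta>_verts fin(1) fibre_verts] by blast
  obtain b where b: "bij_betw b (arcs H) (arcs H)"
    and bp: "\<And>x. x \<in> arcs G \<Longrightarrow> b (snd p x) = snd p (snd \<beta> x)"
    using map_descends[OF p_arcs \<beta>_arcs fin(2) fibre_arcs] by blast
  note p_ends = epimorphism_ends[OF p] and \<beta>_ends = automorphism_ends[OF \<beta>]
  have "tail H (b y) = a (tail H y) \<and> head H (b y) = a (head H y) \<and>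
      arc_inv H (b y) = b (arc_inv H y)" if "y \<in> arcs H" for y
  proof -
    have "y \<in> snd p ` arcs G" using that by (simp only: p_arcs)
    then obtain x where y: "y = snd p x" and x: "x \<in> arcs G" by blast
    have \<beta>x: "snd \<beta> x \<in> arcs G" using imageI[OF x, of "snd \<beta>"] unfolding \<beta>_arcs .
    have "tail G x \<in> verts G" "head G x \<in> verts G" "arc_inv G x \<in> arcs G"
      using G x by (auto simp: closed_graph_def)
    then show ?thesis
      by (simp only: y p_ends[OF x] p_ends[OF \<beta>x] \<beta>_ends[OF x] bp[OF x] ap bp)
  qed
  then have "graph_automorphism H (a, b)"
    using a b unfolding graph_automorphism_def fst_conv snd_conv by (intro conjI ballI) simp_all
  then show thesis
    by (rule that) (simp_all only: fst_conv snd_conv ap bp)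
qed

lemma inverse_epimorphism:
  assumes G: "closed_graph G" and p: "graph_epimorphism G H p"
    and inj: "inj_on (fst p) (verts G)" "inj_on (snd p) (arcs G)"
  shows "graph_epimorphism H G (inv_into (verts G) (fst p), inv_into (arcs G) (snd p))"
proof -
  have p_verts: "fst p ` verts G = verts H" and p_arcs: "snd p ` arcs G = arcs H"
    using p by (rule epimorphism_images)+
  have "tail G (inv_into (arcs G) (snd p) y) = inv_into (verts G) (fst p) (tail H y) \<and>
      head G (inv_into (arcs G) (snd p) y) = inv_into (verts G) (fst p) (head H y) \<and>
      arc_inv G (inv_into (arcs G) (snd p) y) = inv_into (arcs G) (snd p) (arc_inv H y)"
    if "y \<in> arcs H" for y
  proof -
    have "y \<in> snd p ` arcs G" using that by (simp only: p_arcs)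
    then obtain x where y: "y = snd p x" and x: "x \<in> arcs G" by blast
    have "tail G x \<in> verts G" "head G x \<in> verts G" "arc_inv G x \<in> arcs G"
      using G x by (auto simp: closed_graph_def)
    then show ?thesis
      by (simp only: y epimorphism_ends[OF p x] inv_into_f_f[OF inj(1)] inv_into_f_f[OF inj(2)] x)
  qed
  moreover have "inv_into (verts G) (fst p) ` verts H = verts G"
    and "inv_into (arcs G) (snd p) ` arcs H = arcs G"
    unfolding p_verts[symmetric] p_arcs[symmetric]
    by (simp_all only: inv_into_image_cancel[OF inj(1)] inv_into_image_cancel[OF inj(2)] subset_refl)
  ultimately show ?thesis
    unfolding graph_epimorphism_def fst_conv snd_conv by (intro conjI ballI) simp_all
qed

lemma epimorphism_closed:
  assumes "closed_graph G" and "graph_epimorphism G H p"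
  shows "closed_graph H"
proof -
  have "tail H (snd p x) \<in> verts H \<and> head H (snd p x) \<in> verts H \<and> arc_inv H (snd p x) \<in> arcs H"
    if "x \<in> arcs G" for x
    using assms that unfolding closed_graph_def graph_epimorphism_def by (metis imageI)
  moreover have "arcs H = snd p ` arcs G" using assms(2) by (simp add: graph_epimorphism_def)
  ultimately show ?thesis by (auto simp: closed_graph_def)
qed

text \<open>
  Conjugation by an isomorphism, obtained by letting \<open>\<alpha>\<close> descend along the inverse isomorphism,
  whose fibres are points.
\<close>

lemma automorphism_transports:
  assumes G: "closed_graph G" and H: "closed_graph H" and p: "graph_epimorphism G H p"
    and inj: "inj_on (fst p) (verts G)" "inj_on (snd p) (arcs G)"
    and fin: "finite (verts G)" "finite (arcs G)"
    and \<alpha>: "graph_automorphism H \<alpha>"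
  obtains \<beta> where "graph_automorphism G \<beta>"
    and "\<And>v. v \<in> verts G \<Longrightarrow> fst p (fst \<beta> v) = fst \<alpha> (fst p v)"
    and "\<And>x. x \<in> arcs G \<Longrightarrow> snd p (snd \<beta> x) = snd \<alpha> (snd p x)"
proof -
  have p_verts: "fst p ` verts G = verts H" and p_arcs: "snd p ` arcs G = arcs H"
    using p by (rule epimorphism_images)+
  have \<alpha>_verts: "fst \<alpha> ` verts H = verts H" and \<alpha>_arcs: "snd \<alpha> ` arcs H = arcs H"
    using \<alpha> by (rule automorphism_images)+
  let ?q = "(inv_into (verts G) (fst p), inv_into (arcs G) (snd p))"
  have q: "graph_epimorphism H G ?q" using G p inj by (rule inverse_epimorphism)
  have q_inj: "inj_on (fst ?q) (verts H)" "inj_on (snd ?q) (arcs H)"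
    by (simp_all add: inj_on_inv_into flip: p_verts p_arcs)
  have q_fibre_verts: "fst ?q (fst \<alpha> v) = fst ?q (fst \<alpha> w)"
    if "v \<in> verts H" "w \<in> verts H" "fst ?q v = fst ?q w" for v w
    using inj_onD[OF q_inj(1) that(3,1,2)] by simp
  have q_fibre_arcs: "snd ?q (snd \<alpha> x) = snd ?q (snd \<alpha> y)"
    if "x \<in> arcs H" "y \<in> arcs H" "snd ?q x = snd ?q y" for x y
    using inj_onD[OF q_inj(2) that(3,1,2)] by simp
  obtain \<beta> where \<beta>: "graph_automorphism G \<beta>"
    and \<beta>v: "\<And>w. w \<in> verts H \<Longrightarrow> fst \<beta> (fst ?q w) = fst ?q (fst \<alpha> w)"
    and \<beta>x: "\<And>y. y \<in> arcs H \<Longrightarrow> snd \<beta> (snd ?q y) = snd ?q (snd \<alpha> y)"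
    using automorphism_descends[OF H q fin \<alpha> q_fibre_verts q_fibre_arcs] by blast
  show thesis
  proof (rule that[OF \<beta>])
    fix v assume v: "v \<in> verts G"
    then have pv: "fst p v \<in> verts H" using p_verts by blast
    have qv: "fst ?q (fst p v) = v" using inj(1) v by simp
    have "fst \<alpha> (fst p v) \<in> fst p ` verts G" using pv \<alpha>_verts p_verts by blast
    with \<beta>v[OF pv] show "fst p (fst \<beta> v) = fst \<alpha> (fst p v)"
      unfolding qv by (simp add: f_inv_into_f)
  next
    fix x assume x: "x \<in> arcs G"
    then have px: "snd p x \<in> arcs H" using p_arcs by blast
    have qx: "snd ?q (snd p x) = x" using inj(2) x by simp
    have "snd \<alpha> (snd p x) \<in> snd p ` arcs G" using px \<alpha>_arcs p_arcs by blast
    with \<beta>x[OF px] show "snd p (snd \<beta> x) = snd \<alpha> (snd p x)"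
      unfolding qx by (simp add: f_inv_into_f)
  qed
qed


section \<open>Lifts to a derived graph\<close>

lemma derived_graph_closed:
  assumes "closed_graph G" and "group A" and "voltage_assignment G A \<phi>"
  shows "closed_graph (derived_graph G A \<phi>)"
proof -
  interpret group A by fact
  have "\<phi> x \<in> carrier A" if "x \<in> arcs G" for x
    using assms(3) that by (simp add: voltage_assignment_def)
  then show ?thesis
    using assms(1) by (auto simp: closed_graph_def derived_graph_def)
qed

text \<open>
  Let \<open>b v a\<close> be the group coordinate of \<open>\<beta> (v, a)\<close>.  Walking along an arc multiplies both
  \<open>b v (c a)\<close> and \<open>b v a\<close> on the right by the voltage of the image arc, so \<open>b v (c a) (b v a)\<^sup>-\<^sup>1\<close> is constant
  on the connected graph.  Its value is the twist \<open>f c\<close>; comparing \<open>f (c c')\<close> with two successive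
  translations shows that \<open>f\<close> is a homomorphism, and it is injective because \<open>\<beta>\<close> is.
\<close>

lemma lift_twists_translations:
  assumes A: "group A" and fin: "finite (carrier A)"
    and G: "closed_graph G" and \<phi>: "voltage_assignment G A \<phi>"
    and conn: "connected_graph (derived_graph G A \<phi>)"
    and \<alpha>: "graph_automorphism G \<alpha>"
    and lift: "is_lift (derived_graph G A \<phi>) (fst, fst) \<beta> \<alpha>"
  obtains f where "f \<in> auto A"
    and "\<And>v a c. v \<in> verts G \<Longrightarrow> a \<in> carrier A \<Longrightarrow> c \<in> carrier A \<Longrightarrow>
           snd (fst \<beta> (v, c \<otimes>\<^bsub>A\<^esub> a)) = f c \<otimes>\<^bsub>A\<^esub> snd (fst \<beta> (v, a))"
    and "\<And>x a c. x \<in> arcs G \<Longrightarrow> a \<in> carrier A \<Longrightarrow> c \<in> carrier A \<Longrightarrow>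
           snd (snd \<beta> (x, c \<otimes>\<^bsub>A\<^esub> a)) = f c \<otimes>\<^bsub>A\<^esub> snd (snd \<beta> (x, a))"
proof -
  interpret group A by fact
  let ?D = "derived_graph G A \<phi>"
  define b where "b v a = snd (fst \<beta> (v, a))" for v a
  have \<beta>: "graph_automorphism ?D \<beta>" using lift by (simp add: is_lift_def)
  have \<beta>_inj: "inj_on (fst \<beta>) (verts G \<times> carrier A)"
    and \<beta>_verts: "fst \<beta> ` (verts G \<times> carrier A) = verts G \<times> carrier A"
    and \<beta>_arcs: "snd \<beta> ` (arcs G \<times> carrier A) = arcs G \<times> carrier A"
    using \<beta> by (auto simp: graph_automorphism_def bij_betw_def derived_graph_def)
  have \<beta>v: "fst \<beta> (v, a) = (fst \<alpha> v, b v a)" if "v \<in> verts G" "a \<in> carrier A" for v a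
    using lift that by (auto simp: is_lift_def derived_graph_def b_def prod_eq_iff)
  have b_closed: "b v a \<in> carrier A" if "v \<in> verts G" "a \<in> carrier A" for v a
    using \<beta>v[OF that] \<beta>_verts that by (metis SigmaI imageI mem_Sigma_iff)
  have \<beta>x: "snd \<beta> (x, a) = (snd \<alpha> x, b (tail G x) a)"
    and b_head: "b (head G x) (a \<otimes>\<^bsub>A\<^esub> \<phi> x) = b (tail G x) a \<otimes>\<^bsub>A\<^esub> \<phi> (snd \<alpha> x)"
    if x: "x \<in> arcs G" and a: "a \<in> carrier A" for x a
  proof -
    have ends: "tail G x \<in> verts G" "head G x \<in> verts G" "\<phi> x \<in> carrier A"
      using x G \<phi> by (auto simp: closed_graph_def voltage_assignment_def)
    have "fst (snd \<beta> (x, a)) = snd \<alpha> x"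
      using lift x a by (auto simp: is_lift_def derived_graph_def)
    moreover have "tail ?D (snd \<beta> (x, a)) = fst \<beta> (tail G x, a)"
      and hd: "head ?D (snd \<beta> (x, a)) = fst \<beta> (head G x, a \<otimes>\<^bsub>A\<^esub> \<phi> x)"
      using \<beta> x a by (auto simp: graph_automorphism_def derived_graph_def)
    ultimately show \<beta>x: "snd \<beta> (x, a) = (snd \<alpha> x, b (tail G x) a)"
      using \<beta>v[of "tail G x" a] ends a
      by (auto simp: derived_graph_def prod_eq_iff split: prod.splits)
    show "b (head G x) (a \<otimes>\<^bsub>A\<^esub> \<phi> x) = b (tail G x) a \<otimes>\<^bsub>A\<^esub> \<phi> (snd \<alpha> x)"
      using hd \<beta>v[of "head G x" "a \<otimes>\<^bsub>A\<^esub> \<phi> x"] ends a by (simp add: \<beta>x derived_graph_def)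
  qed
  (* the displacement that turns out not to depend on the point, only on c *)
  define h where "h c = (\<lambda>(v, a). b v (c \<otimes>\<^bsub>A\<^esub> a) \<otimes>\<^bsub>A\<^esub> inv\<^bsub>A\<^esub> b v a)" for c
  have h_const: "h c u = h c w"
    if c: "c \<in> carrier A" and u: "u \<in> verts ?D" and w: "w \<in> verts ?D" for c u w
  proof (rule connected_graph_invariant[OF conn _ u w])
    fix y assume "y \<in> arcs ?D"
    then obtain x a where y: "y = (x, a)" and x: "x \<in> arcs G" and a: "a \<in> carrier A"
      by (auto simp: derived_graph_def)
    have ends: "tail G x \<in> verts G" "head G x \<in> verts G" "\<phi> x \<in> carrier A"
      using x G \<phi> by (auto simp: closed_graph_def voltage_assignment_def)
    have \<phi>\<alpha>: "\<phi> (snd \<alpha> x) \<in> carrier A"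
      using x \<alpha> \<phi> by (auto simp: graph_automorphism_def bij_betw_def voltage_assignment_def)
    have "c \<otimes>\<^bsub>A\<^esub> (a \<otimes>\<^bsub>A\<^esub> \<phi> x) = (c \<otimes>\<^bsub>A\<^esub> a) \<otimes>\<^bsub>A\<^esub> \<phi> x" using c a ends by (simp add: m_assoc)
    then have "h c (head ?D y) =
        (b (tail G x) (c \<otimes>\<^bsub>A\<^esub> a) \<otimes>\<^bsub>A\<^esub> \<phi> (snd \<alpha> x)) \<otimes>\<^bsub>A\<^esub> inv\<^bsub>A\<^esub> (b (tail G x) a \<otimes>\<^bsub>A\<^esub> \<phi> (snd \<alpha> x))"
      using c a x by (simp add: h_def y derived_graph_def b_head)
    also have "\<dots> = b (tail G x) (c \<otimes>\<^bsub>A\<^esub> a) \<otimes>\<^bsub>A\<^esub> inv\<^bsub>A\<^esub> b (tail G x) a"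
      using c a ends \<phi>\<alpha> b_closed
      by (simp add: inv_mult_group m_assoc inv_solve_left') (simp add: m_assoc [symmetric])
    also have "\<dots> = h c (tail ?D y)" by (simp add: h_def y derived_graph_def)
    finally show "h c (tail ?D y) = h c (head ?D y)" by simp
  qed
  obtain v0 where v0: "v0 \<in> verts G"
    using conn by (auto simp: connected_graph_def connected_def strongly_connected_def
        mk_symmetric_def pre_digraph.truncate_def derived_graph_def)
  (* restricted to the carrier, since members of auto A are extensional functions *)
  define f where "f = (\<lambda>c\<in>carrier A. h c (v0, \<one>\<^bsub>A\<^esub>))"
  have f_closed: "f c \<in> carrier A" if "c \<in> carrier A" for c
    using that v0 b_closed by (simp add: f_def h_def)
  have twist: "b v (c \<otimes>\<^bsub>A\<^esub> a) = f c \<otimes>\<^bsub>A\<^esub> b v a"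
    if v: "v \<in> verts G" and a: "a \<in> carrier A" and c: "c \<in> carrier A" for v a c
  proof -
    have "f c = b v (c \<otimes>\<^bsub>A\<^esub> a) \<otimes>\<^bsub>A\<^esub> inv\<^bsub>A\<^esub> b v a"
      using h_const[OF c, of "(v0, \<one>\<^bsub>A\<^esub>)" "(v, a)"] v v0 a c
      by (simp add: f_def h_def derived_graph_def)
    then show ?thesis using v a c b_closed by (simp add: m_assoc)
  qed
  (* both sides of the homomorphism law are compared at the point (v0, 1) *)
  have f_mult: "f (c \<otimes>\<^bsub>A\<^esub> c') = f c \<otimes>\<^bsub>A\<^esub> f c'" if c: "c \<in> carrier A" "c' \<in> carrier A" for c c'
  proof -
    have "f (c \<otimes>\<^bsub>A\<^esub> c') \<otimes>\<^bsub>A\<^esub> b v0 \<one>\<^bsub>A\<^esub> = b v0 (c \<otimes>\<^bsub>A\<^esub> (c' \<otimes>\<^bsub>A\<^esub> \<one>\<^bsub>A\<^esub>))"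
      using twist[OF v0, of "\<one>\<^bsub>A\<^esub>" "c \<otimes>\<^bsub>A\<^esub> c'"] c by simp
    also have "\<dots> = (f c \<otimes>\<^bsub>A\<^esub> f c') \<otimes>\<^bsub>A\<^esub> b v0 \<one>\<^bsub>A\<^esub>"
      using c f_closed b_closed[OF v0] by (simp only: twist[OF v0] m_closed one_closed m_assoc)
    finally show ?thesis using c f_closed b_closed[OF v0] by simp
  qed
  have "inj_on f (carrier A)"
  proof (rule inj_onI)
    fix c c' assume c: "c \<in> carrier A" "c' \<in> carrier A" and "f c = f c'"
    then have "b v0 c = b v0 c'" using twist[OF v0 one_closed] by (metis r_one)
    then have "fst \<beta> (v0, c) = fst \<beta> (v0, c')" using c v0 by (simp add: \<beta>v)
    then show "c = c'" using \<beta>_inj c v0 by (auto dest: inj_onD)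
  qed
  moreover have "f ` carrier A \<subseteq> carrier A" using f_closed by blast
  ultimately have "bij_betw f (carrier A) (carrier A)"
    using fin by (simp add: bij_betw_def endo_inj_surj)
  then have "f \<in> auto A"
    using f_closed f_mult by (auto simp: auto_def Bij_def hom_def f_def)
  then show thesis
  proof (rule that)
    fix x a c assume "x \<in> arcs G" "a \<in> carrier A" "c \<in> carrier A"
    then show "snd (snd \<beta> (x, c \<otimes>\<^bsub>A\<^esub> a)) = f c \<otimes>\<^bsub>A\<^esub> snd (snd \<beta> (x, a))"
      using G by (simp add: \<beta>x twist closed_graph_def)
  qed (use twist in \<open>simp add: b_def\<close>)
qed


section \<open>The solvable cover over the levels of the tower\<close>

lemma relabel_simps:
  assumes "inj a" "inj b"
  shows "verts (relabel a b G) = a ` verts G" and "arcs (relabel a b G) = b ` arcs G"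
    and "x \<in> arcs G \<Longrightarrow> tail (relabel a b G) (b x) = a (tail G x)"
    and "x \<in> arcs G \<Longrightarrow> head (relabel a b G) (b x) = a (head G x)"
    and "x \<in> arcs G \<Longrightarrow> arc_inv (relabel a b G) (b x) = b (arc_inv G x)"
  using assms by (simp_all add: relabel_def inj_on_subset inv_into_f_f)

lemma inj_Base: "inj Base" and inj_Over: "inj (case_prod Over)"
  by (auto intro!: injI)

text \<open>
  The iterated cover \<open>T i\<close> with voltages \<open>\<phi>\<^sup>(\<^sup>i\<^sup>)\<close> in \<open>N i\<close> has a derived graph isomorphic to \<open>D\<close>.  In
  terms of a point \<open>(b, a)\<close> of \<open>D\<close>, the isomorphism is \<open>(b, a) \<mapsto> (tower_point i (b, a), fibre_coord i a)\<close>: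
  at each level the element \<open>r = fibre_coord i a\<close> of \<open>N i\<close> is split into its coset \<open>q\<close> modulo
  \<open>N (i + 1)\<close>, which becomes the new coordinate of the point, and the remainder
  \<open>r \<kappa>(q)\<^sup>-\<^sup>1\<close>, which lies in \<open>N (i + 1)\<close>.  The morphism \<open>p\<^sub>i\<close> is \<open>tower_point i\<close>, both on
  vertices and on arcs.
\<close>

context
  fixes A :: "('g, 'm) monoid_scheme" and N :: "nat \<Rightarrow> 'g set"
    and \<kappa> :: "nat \<Rightarrow> 'g set \<Rightarrow> 'g"
begin

primrec fibre_coord :: "nat \<Rightarrow> 'g \<Rightarrow> 'g" where
  "fibre_coord 0 a = a"
| "fibre_coord (Suc i) a =
     fibre_coord i a \<otimes>\<^bsub>A\<^esub> inv\<^bsub>A\<^esub> \<kappa> i (N (Suc i) #>\<^bsub>A\<^esub> fibre_coord i a)"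

primrec tower_point :: "nat \<Rightarrow> 'b \<times> 'g \<Rightarrow> ('b, 'g set) tower_pt" where
  "tower_point 0 z = Base (fst z)"
| "tower_point (Suc i) z = Over (tower_point i z) (N (Suc i) #>\<^bsub>A\<^esub> fibre_coord i (snd z))"

end

locale solvable_tower = group A for A :: "('g, 'm) monoid_scheme" (structure) +
  fixes d :: nat and N :: "nat \<Rightarrow> 'g set" and \<kappa> :: "nat \<Rightarrow> 'g set \<Rightarrow> 'g"
    and \<Gamma> :: "('v, 'e) vgraph" and \<phi> :: "'e \<Rightarrow> 'g"
  assumes series: "characteristic_abelian_series A d N"
    and sections: "series_sections A d N \<kappa>"
    and closed: "closed_graph \<Gamma>"
    and voltage: "voltage_assignment \<Gamma> A \<phi>"
begin

abbreviation "coord \<equiv> fibre_coord A N \<kappa>"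
abbreviation "point \<equiv> tower_point A N \<kappa>"
abbreviation "T \<equiv> tower \<Gamma> A N \<kappa> \<phi>"
abbreviation "D \<equiv> derived_graph \<Gamma> A \<phi>"

lemma N_0: "N 0 = carrier A" and N_last: "N (Suc d) = {\<one>}"
  using series by (auto simp: characteristic_abelian_series_def)

lemma N_characteristic: "i \<le> d \<Longrightarrow> characteristic_subgroup (N i) A"
  using series by (auto simp: characteristic_abelian_series_def)

lemma N_normal: "i \<le> d \<Longrightarrow> N (Suc i) \<lhd> A\<lparr>carrier := N i\<rparr>"
  using series by (auto simp: characteristic_abelian_series_def)

lemma N_subgroup: "i \<le> Suc d \<Longrightarrow> subgroup (N i) A"
  using N_characteristic[of i] N_last triv_subgroup
  by (cases "i = Suc d") (auto simp: characteristic_subgroup_def)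

lemma N_Suc_subset: "i \<le> d \<Longrightarrow> N (Suc i) \<subseteq> N i"
  using subgroup.subset[OF normal_imp_subgroup[OF N_normal]] by simp

lemma N_carrier: "i \<le> Suc d \<Longrightarrow> x \<in> N i \<Longrightarrow> x \<in> carrier A"
  by (rule subgroup.mem_carrier[OF N_subgroup])

text \<open>
  About the twist of a lift nothing is known beyond its being an automorphism of \<open>A\<close>; it
  preserves the series because the terms of the series are characteristic.
\<close>

lemma N_invariant:
  assumes "f \<in> auto A" "i \<le> Suc d" "n \<in> N i"
  shows "f n \<in> N i"
proof (cases "i = Suc d")
  case True
  have "f \<in> hom A A" using assms(1) by (simp add: auto_def)
  then have "f \<one> = \<one>" using hom_one is_group by blast
  then show ?thesis using assms(3) True N_last by simp
next
  case False
  then have "f ` N i = N i"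
    using assms N_characteristic[of i] by (simp add: characteristic_subgroup_def)
  then show ?thesis using assms(3) by blast
qed

lemma factor_carrier: "carrier (series_factor A N i) = (\<lambda>x. N (Suc i) #> x) ` N i"
  by (auto simp: FactGroup_def RCOSETS_def r_coset_def)

lemma factor_mult:
  assumes "i \<le> d" "x \<in> N i" "y \<in> N i"
  shows "(N (Suc i) #> x) \<otimes>\<^bsub>series_factor A N i\<^esub> (N (Suc i) #> y) = N (Suc i) #> (x \<otimes> y)"
  using normal.rcos_sum[OF N_normal[OF assms(1)], of x y] assms(2,3)
  by (simp add: r_coset_def set_mult_def)

lemma section_coset:
  assumes "i \<le> d" "x \<in> N i"
  shows "\<kappa> i (N (Suc i) #> x) \<in> N i"
    and "N (Suc i) #> \<kappa> i (N (Suc i) #> x) = N (Suc i) #> x"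
  using sections assms by (auto simp: series_sections_def factor_carrier)

lemma coord_closed: "i \<le> Suc d \<Longrightarrow> a \<in> carrier A \<Longrightarrow> coord i a \<in> N i"
proof (induction i)
  case 0
  then show ?case by (simp add: N_0)
next
  case (Suc i)
  let ?r = "coord i a" and ?M = "N (Suc i)"
  have r: "?r \<in> N i" and i: "i \<le> d" using Suc by auto
  have M: "subgroup ?M A" using N_subgroup[of "Suc i"] i by simp
  have c: "?r \<in> carrier A" "\<kappa> i (?M #> ?r) \<in> carrier A"
    using r section_coset(1)[OF i r] N_carrier[of i] i by auto
  have "?r \<in> ?M #> \<kappa> i (?M #> ?r)"
    using rcos_self[OF c(1) M] section_coset(2)[OF i r] by simp
  then obtain m where m: "m \<in> ?M" "?r = m \<otimes> \<kappa> i (?M #> ?r)"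
    by (auto simp: r_coset_def)
  have "?r \<otimes> inv \<kappa> i (?M #> ?r) = m"
    using m c N_carrier[of "Suc i" m] i by (metis inv_solve_right' Suc_le_mono)
  then show ?case using m(1) by simp
qed

lemma coord_carrier: "i \<le> Suc d \<Longrightarrow> a \<in> carrier A \<Longrightarrow> coord i a \<in> carrier A"
  using coord_closed N_carrier by blast

lemma coset_absorb:
  assumes "i \<le> Suc d" "n \<in> N i" "x \<in> carrier A"
  shows "N i #> (n \<otimes> x) = N i #> x"
  using assms N_subgroup[of i] N_carrier[of i n]
  by (metis coset_join2 coset_mult_assoc subgroup.subset)

text \<open>
  Left translation by \<open>n\<close> in \<open>N i\<close> does not affect the cosets modulo \<open>N 1, \<dots>, N i\<close> that have been
  split off so far, so the whole factor \<open>n\<close> is left in the remainder.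
\<close>

lemma translate_in_fibre:
  assumes "i \<le> Suc d" "a \<in> carrier A" "n \<in> N i"
  shows "coord i (n \<otimes> a) = n \<otimes> coord i a" and "point i (b, n \<otimes> a) = point i (b, a)"
  using assms
proof (induction i)
  case (Suc i)
  { case 1
    have n: "n \<in> N i" "n \<in> carrier A"
      using 1 N_Suc_subset[of i] N_carrier[of "Suc i" n] by auto
    have r: "coord i a \<in> N i" using 1 coord_closed by simp
    have "\<kappa> i (N (Suc i) #> coord i a) \<in> carrier A"
      using section_coset(1)[OF _ r] 1 N_carrier[of i] by simp
    then show ?case
      using 1 n Suc coord_carrier[of i a] by (simp add: coset_absorb m_assoc) }
  { case 2
    have n: "n \<in> N i" using 2 N_Suc_subset[of i] by auto
    show ?case using 2 n Suc coord_carrier[of i a] by (simp add: coset_absorb) }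
qed auto

text \<open>
  Conversely, if two points agree up to level \<open>i + 1\<close>, they differ by a translation by some
  \<open>n\<close> in \<open>N i\<close>, and equality of the last cosets, that of \<open>r\<close> and that of \<open>n r\<close>, forces \<open>n\<close> into
  \<open>N (i + 1)\<close>.
\<close>

lemma same_fibre_translate:
  assumes "i \<le> Suc d" "a \<in> carrier A" "a' \<in> carrier A" "point i (b, a) = point i (b', a')"
  shows "b = b' \<and> (\<exists>n\<in>N i. a' = n \<otimes> a)"
  using assms
proof (induction i)
  case 0
  have "a' = (a' \<otimes> inv a) \<otimes> a" using 0 by (simp add: m_assoc)
  then show ?case using 0 by (auto simp: N_0)
next
  case (Suc i)
  then obtain n where b: "b = b'" and n: "n \<in> N i" "a' = n \<otimes> a" by auto
  let ?r = "coord i a"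
  have r: "?r \<in> carrier A" and nc: "n \<in> carrier A"
    using Suc.prems coord_carrier[of i a] N_carrier[of i n] n by auto
  have M: "subgroup (N (Suc i)) A" using N_subgroup Suc.prems by blast
  have "N (Suc i) #> (n \<otimes> ?r) = N (Suc i) #> ?r"
    using Suc.prems n translate_in_fibre(1)[of i a n] by simp
  then have "n \<otimes> ?r \<in> N (Suc i) #> ?r"
    using rcos_self[OF m_closed[OF nc r] M] by simp
  then obtain m where "m \<in> N (Suc i)" "n \<otimes> ?r = m \<otimes> ?r" by (auto simp: r_coset_def)
  moreover from this have "n = m"
    using r nc subgroup.mem_carrier[OF M] by (metis r_cancel)
  ultimately show ?case using b n by auto
qed

lemma base_points: "(\<lambda>z. Base (fst z)) ` (S \<times> carrier A) = Base ` S"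
  by (force intro!: image_eqI[where x = "(_, \<one>)"])

text \<open>
  A prescribed last coset \<open>N (i + 1) m\<close> is reached by translating with \<open>m r\<^sup>-\<^sup>1\<close>, where \<open>r\<close> is the
  remainder at level \<open>i\<close>; as this element lies in \<open>N i\<close>, the point at level \<open>i\<close> stays put.
\<close>

lemma points_onto:
  assumes "i \<le> d"
  shows "point (Suc i) ` (S \<times> carrier A) =
    case_prod Over ` (point i ` (S \<times> carrier A) \<times> carrier (series_factor A N i))"
proof (intro equalityI subsetI)
  fix w assume "w \<in> point (Suc i) ` (S \<times> carrier A)"
  then show "w \<in> case_prod Over ` (point i ` (S \<times> carrier A) \<times> carrier (series_factor A N i))"
    using assms coord_closed[of i] unfolding factor_carrier by force
next
  fix w assume "w \<in> case_prod Over ` (point i ` (S \<times> carrier A) \<times> carrier (series_factor A N i))"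
  then obtain b a m where w: "w = Over (point i (b, a)) (N (Suc i) #> m)"
    and b: "b \<in> S" and a: "a \<in> carrier A" and m: "m \<in> N i"
    unfolding factor_carrier by auto
  let ?n = "m \<otimes> inv (coord i a)"
  have sub: "subgroup (N i) A" using N_subgroup assms by simp
  have r: "coord i a \<in> N i" using coord_closed a assms by simp
  have n: "?n \<in> N i" using m r sub by (simp add: subgroup.m_closed subgroup.m_inv_closed)
  have "?n \<otimes> coord i a = m"
    using m r subgroup.mem_carrier[OF sub] by (simp add: m_assoc)
  then have "w = point (Suc i) (b, ?n \<otimes> a)"
    using w translate_in_fibre(1)[OF _ a n] translate_in_fibre(2)[OF _ a n, of b] assms by simp
  moreover have "?n \<otimes> a \<in> carrier A" using n a subgroup.mem_carrier[OF sub] by simp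
  ultimately show "w \<in> point (Suc i) ` (S \<times> carrier A)" using b by blast
qed

lemma top_points_inj: "inj_on (point (Suc d)) (S \<times> carrier A)"
proof (rule inj_onI)
  fix z z' assume z: "z \<in> S \<times> carrier A" "z' \<in> S \<times> carrier A"
    "point (Suc d) z = point (Suc d) z'"
  obtain b a b' a' where zz: "z = (b, a)" "z' = (b', a')" "a \<in> carrier A" "a' \<in> carrier A"
    using z(1,2) by blast
  then show "z = z'"
    using same_fibre_translate[OF order_refl zz(3,4), of b b'] z(3) N_last
    by (simp del: tower_point.simps)
qed

lemma volt_closed: "x \<in> arcs \<Gamma> \<Longrightarrow> \<phi> x \<in> carrier A"
  using voltage by (simp add: voltage_assignment_def)

text \<open>
  The formula for \<open>\<phi>\<^sup>(\<^sup>i\<^sup>+\<^sup>1\<^sup>)\<close> is what makes the remainders behave like the group coordinate of a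
  derived graph over \<open>T i\<close>: passing to the remainder divides the two ends of an arc by
  \<open>\<kappa>(q)\<close> and \<open>\<kappa>(q')\<close>, and \<open>\<kappa>(q) u \<kappa>(q')\<^sup>-\<^sup>1\<close> compensates for this.
\<close>

lemma coord_voltage:
  assumes "i \<le> Suc d" "x \<in> arcs \<Gamma>" "a \<in> carrier A"
  shows "coord i (a \<otimes> \<phi> x) = coord i a \<otimes> tower_volt A N \<kappa> \<phi> i (point i (x, a))"
    and "tower_volt A N \<kappa> \<phi> i (point i (x, a)) \<in> N i"
proof -
  have cancel: "inv g \<otimes> (g \<otimes> h) = h" if "g \<in> carrier A" "h \<in> carrier A" for g h
    using that by (simp flip: m_assoc)
  have "coord i (a \<otimes> \<phi> x) = coord i a \<otimes> tower_volt A N \<kappa> \<phi> i (point i (x, a)) \<and>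
      tower_volt A N \<kappa> \<phi> i (point i (x, a)) \<in> N i"
    using assms(1)
  proof (induction i)
    case 0
    then show ?case using assms volt_closed by (simp add: N_0)
  next
    case (Suc i)
    let ?r = "coord i a" and ?u = "tower_volt A N \<kappa> \<phi> i (point i (x, a))"
    let ?k = "\<kappa> i (N (Suc i) #> ?r)" and ?k' = "\<kappa> i (N (Suc i) #> (?r \<otimes> ?u))"
    have i: "i \<le> d" and u: "?u \<in> N i" and ru: "coord i (a \<otimes> \<phi> x) = ?r \<otimes> ?u"
      using Suc by auto
    have r: "?r \<in> N i" and r': "?r \<otimes> ?u \<in> N i"
      using coord_closed[of i a] coord_closed[of i "a \<otimes> \<phi> x"] assms i volt_closed ru by auto
    have car: "?r \<in> carrier A" "?u \<in> carrier A" "?k \<in> carrier A" "?k' \<in> carrier A"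
      using r u section_coset(1)[OF i r] section_coset(1)[OF i r'] N_carrier[of i] i by auto
    have volt: "tower_volt A N \<kappa> \<phi> (Suc i) (point (Suc i) (x, a)) = ?k \<otimes> ?u \<otimes> inv ?k'"
      using factor_mult[OF i r u] by (simp add: Let_def)
    have eqn: "coord (Suc i) (a \<otimes> \<phi> x) = coord (Suc i) a \<otimes> (?k \<otimes> ?u \<otimes> inv ?k')"
      using car ru by (simp add: m_assoc cancel)
    have "?k \<otimes> ?u \<otimes> inv ?k' = inv (coord (Suc i) a) \<otimes> coord (Suc i) (a \<otimes> \<phi> x)"
      unfolding eqn using car coord_carrier[OF Suc.prems assms(3)]
      by (intro cancel[symmetric] m_closed inv_closed)
    also have "\<dots> \<in> N (Suc i)"
      using coord_closed[of "Suc i"] N_subgroup[of "Suc i"] Suc.prems assms volt_closed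
      by (meson m_closed subgroup.m_closed subgroup.m_inv_closed)
    finally show ?case using eqn volt by simp
  qed
  then show "coord i (a \<otimes> \<phi> x) = coord i a \<otimes> tower_volt A N \<kappa> \<phi> i (point i (x, a))"
    and "tower_volt A N \<kappa> \<phi> i (point i (x, a)) \<in> N i" by auto
qed

lemma solvable_cover_onto_tower:
  "i \<le> Suc d \<Longrightarrow> graph_epimorphism D (T i) (point i, point i)"
proof (induction i)
  case 0
  show ?case
    by (auto simp: graph_epimorphism_def relabel_simps[OF inj_Base inj_Base] derived_graph_def
        base_points)
next
  case (Suc i)
  let ?E = "derived_graph (T i) (series_factor A N i) (tower_volt_bar A N \<kappa> \<phi> i)"
  have i: "i \<le> d" using Suc.prems by simp
  have IH: "graph_epimorphism D (T i) (point i, point i)" using Suc by simp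
  note relabel = relabel_simps[OF inj_Over inj_Over, where G = ?E]
  have ends: "tail (T (Suc i)) (point (Suc i) z) = point (Suc i) (tail D z) \<and>
      head (T (Suc i)) (point (Suc i) z) = point (Suc i) (head D z) \<and>
      arc_inv (T (Suc i)) (point (Suc i) z) = point (Suc i) (arc_inv D z)"
    if z: "z \<in> arcs D" for z
  proof -
    obtain x a where za: "z = (x, a)" and x: "x \<in> arcs \<Gamma>" and a: "a \<in> carrier A"
      using z by (auto simp: derived_graph_def)
    let ?q = "N (Suc i) #> coord i a"
    have r: "coord i a \<in> N i" using coord_closed a i by simp
    note u = coord_voltage[OF le_SucI[OF i] x a]
    have "point i z \<in> arcs (T i)"
      using imageI[OF z, of "point i"] epimorphism_images(2)[OF IH] by simp
    moreover have "?q \<in> carrier (series_factor A N i)"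
      using r unfolding factor_carrier by blast
    ultimately have arc: "(point i z, ?q) \<in> arcs (T i) \<times> carrier (series_factor A N i)"
      by blast
    then have arc': "(point i z, ?q) \<in> arcs ?E" by (simp add: derived_graph_def)
    have step: "?q \<otimes>\<^bsub>series_factor A N i\<^esub> tower_volt_bar A N \<kappa> \<phi> i (point i z)
        = N (Suc i) #> coord i (a \<otimes> \<phi> x)"
      unfolding tower_volt_bar_def za u(1) using i r u(2) by (rule factor_mult)
    have below: "tail (T i) (point i z) = point i (tail D z)"
      "head (T i) (point i z) = point i (head D z)"
      "arc_inv (T i) (point i z) = point i (arc_inv D z)"
      using epimorphism_ends[OF IH z] by simp_all
    have D: "snd (tail D z) = a" "snd (head D z) = a \<otimes> \<phi> x" "snd (arc_inv D z) = a \<otimes> \<phi> x"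
      using x a by (simp_all add: derived_graph_def za)
    have "tail ?E (point i z, ?q) = (point i (tail D z), ?q)"
      and "head ?E (point i z, ?q) = (point i (head D z), N (Suc i) #> coord i (a \<otimes> \<phi> x))"
      and "arc_inv ?E (point i z, ?q) = (point i (arc_inv D z), N (Suc i) #> coord i (a \<otimes> \<phi> x))"
      using arc unfolding derived_graph_def [of "T i"]
      by (simp_all only: pre_digraph.simps vgraph.simps prod.case below step if_True)
    with relabel(3-5)[OF arc'] show ?thesis
      by (simp only: tower.simps tower_point.simps prod.case D) (simp only: za snd_conv)
  qed
  have T: "verts (T (Suc i)) = case_prod Over ` (verts (T i) \<times> carrier (series_factor A N i))"
    "arcs (T (Suc i)) = case_prod Over ` (arcs (T i) \<times> carrier (series_factor A N i))"
    unfolding tower.simps relabel by (simp_all add: derived_graph_def)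
  have D: "verts D = verts \<Gamma> \<times> carrier A" "arcs D = arcs \<Gamma> \<times> carrier A"
    by (simp_all add: derived_graph_def)
  have "point (Suc i) ` verts D = verts (T (Suc i))"
    and "point (Suc i) ` arcs D = arcs (T (Suc i))"
    using points_onto[OF i, where S = "verts \<Gamma>"] points_onto[OF i, where S = "arcs \<Gamma>"]
      epimorphism_images[OF IH] unfolding T D fst_conv snd_conv by simp_all
  with ends show ?case
    unfolding graph_epimorphism_def fst_conv snd_conv by blast
qed

section \<open>Lifts along the tower\<close>

text \<open>
  The lift sends the orbit of \<open>N i\<close> through a point to the orbit through the image, because
  translation by \<open>n\<close> becomes translation by \<open>f n\<close>, which is again in \<open>N i\<close>.
\<close>

lemma lift_descends_to_tower:
  assumes fin: "finite (carrier A)" "finite (verts \<Gamma>)" "finite (arcs \<Gamma>)"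
    and conn: "connected_graph D" and \<alpha>0: "graph_automorphism \<Gamma> \<alpha>0"
    and lift: "is_lift D (fst, fst) \<beta> \<alpha>0" and i: "i \<le> Suc d"
  obtains \<alpha> where "graph_automorphism (T i) \<alpha>"
    and "\<And>z. z \<in> verts D \<Longrightarrow> fst \<alpha> (point i z) = point i (fst \<beta> z)"
    and "\<And>z. z \<in> arcs D \<Longrightarrow> snd \<alpha> (point i z) = point i (snd \<beta> z)"
proof -
  have \<beta>: "graph_automorphism D \<beta>" using lift by (simp add: is_lift_def)
  obtain f where f: "f \<in> auto A"
    and f_verts: "\<And>v a c. v \<in> verts \<Gamma> \<Longrightarrow> a \<in> carrier A \<Longrightarrow> c \<in> carrier A \<Longrightarrow>
           snd (fst \<beta> (v, c \<otimes> a)) = f c \<otimes> snd (fst \<beta> (v, a))"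
    and f_arcs: "\<And>x a c. x \<in> arcs \<Gamma> \<Longrightarrow> a \<in> carrier A \<Longrightarrow> c \<in> carrier A \<Longrightarrow>
           snd (snd \<beta> (x, c \<otimes> a)) = f c \<otimes> snd (snd \<beta> (x, a))"
    using lift_twists_translations[OF is_group fin(1) closed voltage conn \<alpha>0 lift] by blast
  (* F stands for the vertex map as well as for the arc map of the lift *)
  have fibres: "point i (F z) = point i (F z')"
    if F: "F ` (B \<times> carrier A) = B \<times> carrier A"
      and F_fst: "\<And>b a. b \<in> B \<Longrightarrow> a \<in> carrier A \<Longrightarrow> fst (F (b, a)) = \<alpha> b"
      and F_snd: "\<And>b a c. b \<in> B \<Longrightarrow> a \<in> carrier A \<Longrightarrow> c \<in> carrier A \<Longrightarrow>
        snd (F (b, c \<otimes> a)) = f c \<otimes> snd (F (b, a))"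
      and z: "z \<in> B \<times> carrier A" "z' \<in> B \<times> carrier A" "point i z = point i z'"
    for F :: "'b \<times> 'g \<Rightarrow> 'b \<times> 'g" and B \<alpha> z z'
  proof -
    obtain b a b' a' where "z = (b, a)" "z' = (b', a')" and b: "b \<in> B"
      and a: "a \<in> carrier A" and "a' \<in> carrier A"
      using z(1,2) by blast
    with same_fibre_translate[OF i, of a a' b b'] z(3) obtain n
      where zz: "z = (b, a)" "z' = (b, n \<otimes> a)" and n: "n \<in> N i"
      by auto
    have nc: "n \<in> carrier A" using n i N_carrier by blast
    have "F (b, a) \<in> B \<times> carrier A" using F b a by blast
    then have "snd (F (b, a)) \<in> carrier A" by auto
    moreover have "F (b, n \<otimes> a) = (fst (F (b, a)), f n \<otimes> snd (F (b, a)))"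
      using a b nc F_fst F_snd by (simp add: prod_eq_iff)
    ultimately show ?thesis
      using translate_in_fibre(2)[OF i _ N_invariant[OF f i n],
          where a = "snd (F (b, a))" and b = "fst (F (b, a))"]
      by (simp add: zz)
  qed
  have D: "verts D = verts \<Gamma> \<times> carrier A" "arcs D = arcs \<Gamma> \<times> carrier A"
    by (simp_all add: derived_graph_def)
  have \<beta>_onto: "fst \<beta> ` verts D = verts D" "snd \<beta> ` arcs D = arcs D"
    using \<beta> by (rule automorphism_images)+
  have \<beta>_fst: "\<And>z. z \<in> verts D \<Longrightarrow> fst (fst \<beta> z) = fst \<alpha>0 (fst z)"
    "\<And>z. z \<in> arcs D \<Longrightarrow> fst (snd \<beta> z) = snd \<alpha>0 (fst z)"
    using lift by (auto simp: is_lift_def)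
  have epi: "graph_epimorphism D (T i) (point i, point i)"
    using i by (rule solvable_cover_onto_tower)
  have T: "verts (T i) = point i ` verts D" "arcs (T i) = point i ` arcs D"
    using epi by (auto simp: graph_epimorphism_def)
  have closed_D: "closed_graph D" using closed is_group voltage by (rule derived_graph_closed)
  have fin_T: "finite (verts (T i))" "finite (arcs (T i))"
    using fin by (simp_all add: T D)
  have fibre_verts: "point i (fst \<beta> z) = point i (fst \<beta> z')"
    if z: "z \<in> verts D" "z' \<in> verts D" "point i z = point i z'" for z z'
  proof (rule fibres[of "fst \<beta>" "verts \<Gamma>" "fst \<alpha>0"])
    show "fst \<beta> ` (verts \<Gamma> \<times> carrier A) = verts \<Gamma> \<times> carrier A"
      using \<beta>_onto(1) by (simp only: D)
    show "fst (fst \<beta> (v, a)) = fst \<alpha>0 v" if "v \<in> verts \<Gamma>" "a \<in> carrier A" for v a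
      using \<beta>_fst(1)[of "(v, a)"] that by (simp add: D)
  qed (use z f_verts in \<open>simp_all add: D\<close>)
  have fibre_arcs: "point i (snd \<beta> z) = point i (snd \<beta> z')"
    if z: "z \<in> arcs D" "z' \<in> arcs D" "point i z = point i z'" for z z'
  proof (rule fibres[of "snd \<beta>" "arcs \<Gamma>" "snd \<alpha>0"])
    show "snd \<beta> ` (arcs \<Gamma> \<times> carrier A) = arcs \<Gamma> \<times> carrier A"
      using \<beta>_onto(2) by (simp only: D)
    show "fst (snd \<beta> (x, a)) = snd \<alpha>0 x" if "x \<in> arcs \<Gamma>" "a \<in> carrier A" for x a
      using \<beta>_fst(2)[of "(x, a)"] that by (simp add: D)
  qed (use z f_arcs in \<open>simp_all add: D\<close>)
  show thesis
  proof (rule automorphism_descends[OF closed_D epi fin_T \<beta>], unfold fst_conv snd_conv)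
    fix \<alpha> assume "graph_automorphism (T i) \<alpha>"
      and "\<And>z. z \<in> verts D \<Longrightarrow> fst \<alpha> (point i z) = point i (fst \<beta> z)"
      and "\<And>z. z \<in> arcs D \<Longrightarrow> snd \<alpha> (point i z) = point i (snd \<beta> z)"
    then show thesis by (rule that)
  qed (fact fibre_verts fibre_arcs)+
qed

text \<open>
  At level \<open>0\<close> the induced map is taken to be \<open>base_map \<alpha>0\<close>, which agrees on all points of
  \<open>T 0\<close> with the map induced by \<open>\<beta>\<close>.
\<close>

lemma lifts_to_tower:
  assumes fin: "finite (carrier A)" "finite (verts \<Gamma>)" "finite (arcs \<Gamma>)"
    and conn: "connected_graph D" and \<alpha>0: "graph_automorphism \<Gamma> \<alpha>0"
    and lift: "is_lift D (fst, fst) \<beta> \<alpha>0"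
  obtains \<alpha> where "\<alpha> 0 = base_map \<alpha>0"
    and "\<And>i. i \<le> d \<Longrightarrow> is_lift (T (Suc i)) (under, under) (\<alpha> (Suc i)) (\<alpha> i)"
proof -
  define descends where "descends i \<alpha> \<longleftrightarrow>
      (\<forall>z\<in>verts D. fst \<alpha> (point i z) = point i (fst \<beta> z)) \<and>
      (\<forall>z\<in>arcs D. snd \<alpha> (point i z) = point i (snd \<beta> z))" for i \<alpha>
  have "\<exists>\<alpha>. i \<le> Suc d \<longrightarrow> graph_automorphism (T i) \<alpha> \<and> descends i \<alpha>" for i
    using lift_descends_to_tower[OF assms, of i] unfolding descends_def by metis
  then obtain \<alpha>' where \<alpha>':
    "\<And>i. i \<le> Suc d \<Longrightarrow> graph_automorphism (T i) (\<alpha>' i) \<and> descends i (\<alpha>' i)" by metis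
  define \<alpha> where "\<alpha> i = (if i = 0 then base_map \<alpha>0 else \<alpha>' i)" for i
  have "descends 0 (base_map \<alpha>0)"
    using lift by (simp add: descends_def base_map_def is_lift_def)
  then have \<alpha>: "descends i (\<alpha> i)" if "i \<le> Suc d" for i
    using \<alpha>'[OF that] by (simp add: \<alpha>_def)
  show thesis
  proof (rule that)
    show "\<alpha> 0 = base_map \<alpha>0" by (simp add: \<alpha>_def)
    fix i assume i: "i \<le> d"
    have "graph_epimorphism D (T (Suc i)) (point (Suc i), point (Suc i))"
      using i by (intro solvable_cover_onto_tower) simp
    then have T: "verts (T (Suc i)) = point (Suc i) ` verts D"
        "arcs (T (Suc i)) = point (Suc i) ` arcs D"
      unfolding graph_epimorphism_def by simp_all
    have "graph_automorphism (T (Suc i)) (\<alpha> (Suc i))"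
      using \<alpha>'[of "Suc i"] i by (simp add: \<alpha>_def del: tower.simps)
    then show "is_lift (T (Suc i)) (under, under) (\<alpha> (Suc i)) (\<alpha> i)"
      using \<alpha>[of i] \<alpha>[of "Suc i"] i
      unfolding is_lift_def T by (auto simp: descends_def)
  qed
qed

text \<open>
  The automorphism of \<open>D\<close> obtained from the top of the tower lies over \<open>\<alpha> (d + 1)\<close> along \<open>p\<^sub>d\<^sub>+\<^sub>1\<close>.  Applying the
  projections of the tower one after the other shows that it lies over \<open>\<alpha> i\<close> along every \<open>p\<^sub>i\<close>, and at
  \<open>i = 0\<close> this says that it lifts \<open>\<alpha>0\<close>.
\<close>

lemma lifts_from_tower:
  assumes fin: "finite (carrier A)" "finite (verts \<Gamma>)" "finite (arcs \<Gamma>)"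
    and base: "\<alpha> 0 = base_map \<alpha>0"
    and lifts: "\<And>i. i \<le> d \<Longrightarrow> is_lift (T (Suc i)) (under, under) (\<alpha> (Suc i)) (\<alpha> i)"
  obtains \<beta> where "is_lift D (fst, fst) \<beta> \<alpha>0"
proof -
  have closed_D: "closed_graph D" using closed is_group voltage by (rule derived_graph_closed)
  have epi: "graph_epimorphism D (T i) (point i, point i)" if "i \<le> Suc d" for i
    using that by (rule solvable_cover_onto_tower)
  have fin_D: "finite (verts D)" "finite (arcs D)" using fin by (simp_all add: derived_graph_def)
  have inj_D: "inj_on (fst (point (Suc d), point (Suc d))) (verts D)"
    "inj_on (snd (point (Suc d), point (Suc d))) (arcs D)"
    using top_points_inj by (simp_all add: derived_graph_def del: tower_point.simps)
  have top: "graph_automorphism (T (Suc d)) (\<alpha> (Suc d))"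
    using lifts[of d] by (simp add: is_lift_def del: tower.simps)
  have "\<exists>\<beta>. graph_automorphism D \<beta> \<and>
      (\<forall>z\<in>verts D. point (Suc d) (fst \<beta> z) = fst (\<alpha> (Suc d)) (point (Suc d) z)) \<and>
      (\<forall>z\<in>arcs D. point (Suc d) (snd \<beta> z) = snd (\<alpha> (Suc d)) (point (Suc d) z))"
    by (rule automorphism_transports[OF closed_D epimorphism_closed[OF closed_D epi[OF order_refl]]
        epi[OF order_refl] inj_D fin_D top], unfold fst_conv snd_conv) blast
  then obtain \<beta> where \<beta>: "graph_automorphism D \<beta>"
    and \<beta>v: "\<forall>z\<in>verts D. point (Suc d) (fst \<beta> z) = fst (\<alpha> (Suc d)) (point (Suc d) z)"
    and \<beta>x: "\<forall>z\<in>arcs D. point (Suc d) (snd \<beta> z) = snd (\<alpha> (Suc d)) (point (Suc d) z)"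
    by blast
  have down_verts: "point i (fst \<beta> z) = fst (\<alpha> i) (point i z)"
    if "i \<le> Suc d" "z \<in> verts D" for i z
    using that(1)
  proof (induction rule: inc_induct)
    case base
    show ?case using \<beta>v that(2) by blast
  next
    case (step j)
    have "point (Suc j) z \<in> verts (T (Suc j))"
      using epi[of "Suc j"] step.hyps that(2) unfolding graph_epimorphism_def by auto
    then have "under (fst (\<alpha> (Suc j)) (point (Suc j) z)) = fst (\<alpha> j) (under (point (Suc j) z))"
      using lifts[of j] step.hyps unfolding is_lift_def by auto
    then show ?case unfolding step.IH[symmetric] by simp
  qed
  have down_arcs: "point i (snd \<beta> z) = snd (\<alpha> i) (point i z)"
    if "i \<le> Suc d" "z \<in> arcs D" for i z
    using that(1)
  proof (induction rule: inc_induct)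
    case base
    show ?case using \<beta>x that(2) by blast
  next
    case (step j)
    have "point (Suc j) z \<in> arcs (T (Suc j))"
      using epi[of "Suc j"] step.hyps that(2) unfolding graph_epimorphism_def by auto
    then have "under (snd (\<alpha> (Suc j)) (point (Suc j) z)) = snd (\<alpha> j) (under (point (Suc j) z))"
      using lifts[of j] step.hyps unfolding is_lift_def by auto
    then show ?case unfolding step.IH[symmetric] by simp
  qed
  have "is_lift D (fst, fst) \<beta> \<alpha>0"
    using \<beta> down_verts[of 0] down_arcs[of 0] by (simp add: is_lift_def base base_map_def)
  then show thesis by (rule that)
qed

end

theorem theorem3p5:
  fixes \<Gamma> :: "('v, 'e) vgraph"
    and A :: "('g, 'm) monoid_scheme"
    and d :: nat
    and N :: "nat \<Rightarrow> 'g set"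
    and \<kappa> :: "nat \<Rightarrow> 'g set \<Rightarrow> 'g"
    and \<phi> :: "'e \<Rightarrow> 'g"
    and \<alpha>0 :: "('v \<Rightarrow> 'v) \<times> ('e \<Rightarrow> 'e)"
  assumes "finite_graph \<Gamma>" and "connected_graph \<Gamma>"
    and "group A" and "finite (carrier A)" and "solvable A"
    and "characteristic_abelian_series A d N"
    and "series_sections A d N \<kappa>"
    and "voltage_assignment \<Gamma> A \<phi>"
    and "connected_graph (derived_graph \<Gamma> A \<phi>)"
    and "graph_automorphism \<Gamma> \<alpha>0"
  shows "(\<exists>\<beta>. is_lift (derived_graph \<Gamma> A \<phi>) (fst, fst) \<beta> \<alpha>0) \<longleftrightarrow>
         (\<exists>\<alpha>. \<alpha> 0 = base_map \<alpha>0 \<and>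
              (\<forall>i\<in>{1..d+1}. graph_automorphism (tower \<Gamma> A N \<kappa> \<phi> i) (\<alpha> i) \<and>
                 is_lift (tower \<Gamma> A N \<kappa> \<phi> i) (under, under) (\<alpha> i) (\<alpha> (i - 1))))"
proof -
  interpret group A by fact
  interpret solvable_tower A d N \<kappa> \<Gamma> \<phi>
    using assms finite_graph_closed(1) by unfold_locales
  have fin: "finite (carrier A)" "finite (verts \<Gamma>)" "finite (arcs \<Gamma>)"
    using assms finite_graph_closed(2,3) by auto
  show ?thesis
  proof
    assume "\<exists>\<beta>. is_lift D (fst, fst) \<beta> \<alpha>0"
    then obtain \<beta> where \<beta>: "is_lift D (fst, fst) \<beta> \<alpha>0" ..
    obtain \<alpha> where base: "\<alpha> 0 = base_map \<alpha>0"
      and lift: "\<And>i. i \<le> d \<Longrightarrow> is_lift (T (Suc i)) (under, under) (\<alpha> (Suc i)) (\<alpha> i)"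
      using lifts_to_tower[OF fin assms(9,10) \<beta>] by blast
    have "graph_automorphism (T i) (\<alpha> i) \<and> is_lift (T i) (under, under) (\<alpha> i) (\<alpha> (i - 1))"
      if i: "i \<in> {1..d+1}" for i
    proof -
      have "is_lift (T (Suc (i - 1))) (under, under) (\<alpha> (Suc (i - 1))) (\<alpha> (i - 1))"
        using i by (intro lift) auto
      moreover have "Suc (i - 1) = i" using i by simp
      ultimately have "is_lift (T i) (under, under) (\<alpha> i) (\<alpha> (i - 1))" by (simp only:)
      then show ?thesis unfolding is_lift_def by blast
    qed
    with base show "\<exists>\<alpha>. \<alpha> 0 = base_map \<alpha>0 \<and> (\<forall>i\<in>{1..d+1}. graph_automorphism (T i) (\<alpha> i) \<and>
        is_lift (T i) (under, under) (\<alpha> i) (\<alpha> (i - 1)))"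
      by blast
  next
    assume "\<exists>\<alpha>. \<alpha> 0 = base_map \<alpha>0 \<and> (\<forall>i\<in>{1..d+1}. graph_automorphism (T i) (\<alpha> i) \<and>
        is_lift (T i) (under, under) (\<alpha> i) (\<alpha> (i - 1)))"
    then obtain \<alpha> where base: "\<alpha> 0 = base_map \<alpha>0"
      and lift: "\<forall>i\<in>{1..d+1}. graph_automorphism (T i) (\<alpha> i) \<and>
        is_lift (T i) (under, under) (\<alpha> i) (\<alpha> (i - 1))"
      by (elim exE conjE)
    have "is_lift (T (Suc i)) (under, under) (\<alpha> (Suc i)) (\<alpha> i)" if "i \<le> d" for i
      using lift[rule_format, of "Suc i"] that by (simp del: tower.simps)
    then show "\<exists>\<beta>. is_lift D (fst, fst) \<beta> \<alpha>0"
      using lifts_from_tower[where \<alpha> = \<alpha>, OF fin base] by blast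
  qed
qed

end
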